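(* Let $P$ be an ergodic Markov kernel on a finite set $\mathcal X$, $n=|\mathcal X|\ge3$, reversible with respect to the strictly positive probability distribution $\pi$, and let $k\in\{2,\ldots,n-1\}$. Let $\phi_1,\ldots,\phi_{n-1}$ be the fixed $\pi$-orthonormal eigenbasis of $P^2$ on $\ell_0^2(\pi)$ with eigenvalues in nondecreasing order. Let $\Phi(x)=(\phi_1(x),\ldots,\phi_{k-1}(x))\in\mathbb R^{k-1}$, let $\mathcal U_{k-1}=\operatorname{span}\{\phi_1,\ldots,\phi_{k-1}\}$, and let $E_{k-1}$ be the orthogonal projection of $\ell^2(\pi)$ onto $\mathcal U_{k-1}$. For every partition $\mathcal O=\{O_1,\ldots,O_k\}$ of $\mathcal X$ into $k$ nonempty blocks, with $\delta(\mathcal O)=\sum_{j=1}^{k-1}\|(I-G_{\mathcal O})\phi_j\|_\pi^2$ and $\mu_i=\frac1{\pi(O_i)}\sum_{x\in O_i}\pi(x)\Phi(x)$, $$\delta(\mathcal O)=\sum_{i=1}^k\sum_{x\in O_i}\pi(x)\|\Phi(x)-\mu_i\|_2^2=\frac12\|E_{k-1}-Q_{\mathcal O}\|_{F,\pi}^2=\sum_{j=1}^{k-1}\sin^2\theta_j,$$ where $\theta_1,\ldots,\theta_{k-1}$ are the principal angles between $\mathcal U_{k-1}$ and $\mathcal V_{\mathcal O}$.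
   Context: $\pi(x)>0$ for all $x\in\mathcal X$. $\ell^2(\pi)$ is the space of real functions on $\mathcal X$ with $\langle f,g\rangle_\pi=\sum_x\pi(x)f(x)g(x)$ and norm $\|\cdot\|_\pi$; $\ell^2_0(\pi)=\{f:\sum_x\pi(x)f(x)=0\}$. Kernels act by $(Pf)(x)=\sum_yP(x,y)f(y)$. Ergodic means irreducible and aperiodic; reversible means $\pi(x)P(x,y)=\pi(y)P(y,x)$ for all $x,y$. Let $0\le\eta_1\le\cdots\le\eta_{n-1}<1$ be the eigenvalues of $P^2$ on $\ell^2_0(\pi)$ with multiplicity; $\phi_1,\ldots,\phi_{n-1}$ is a fixed $\pi$-orthonormal basis of $\ell^2_0(\pi)$ with $P^2\phi_j=\eta_j\phi_j$, chosen so that each $\phi_j$ is also an eigenfunction of $P$. $\Pi(x,y)=\pi(y)$. The Gibbs kernel of $\mathcal O$ is $G_{\mathcal O}(x,y)=\sum_{i=1}^k\mathbf 1_{O_i}(x)\mathbf 1_{O_i}(y)\pi(y)/\pi(O_i)$ (replacing a function by its $\pi$-mean on each block). $Q_{\mathcal O}=G_{\mathcal O}-\Pi$ and $\mathcal V_{\mathcal O}=\operatorname{Ran}(Q_{\mathcal O})=\{f\in\ell_0^2(\pi): f\text{ is constant on every }O_i\}$, a subspace of dimension $k-1$. For an operator $A$ on $\ell^2(\pi)$, $\|A\|_{F,\pi}^2=\operatorname{Tr}(A^*A)$. The principal angles $\theta_j\in[0,\pi/2]$ (here $\pi$ is the number) between two $(k-1)$-dimensional subspaces are those whose cosines are the singular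 values of the cross-Gram matrix of $\langle\cdot,\cdot\rangle_\pi$-orthonormal bases of the subspaces. *)

theory Defs
  imports "Jordan_Normal_Form.Char_Poly" "HOL-Analysis.Analysis"
begin

(* Real functions on the finite state space 'a are vectors of type real ^ 'a, and operators on
   them are matrices of type real ^ 'a ^ 'a, acting by  (P *v f) $ x = (\<Sum>y. P $ x $ y * f $ y).
   Jordan_Normal_Form matrices are used only for the cross-Gram matrix, whose size is a natural
   number and not a type. *)

no_notation Matrix.vec_index (infixl "$" 100)


section \<open>The weighted space of functions\<close>

definition prob_weights :: "('a::finite \<Rightarrow> real) \<Rightarrow> bool" where
  "prob_weights \<pi> \<longleftrightarrow> (\<forall>x. 0 < \<pi> x) \<and> (\<Sum>x\<in>UNIV. \<pi> x) = 1"

definition ip :: "('a::finite \<Rightarrow> real) \<Rightarrow> real ^ 'a \<Rightarrow> real ^ 'a \<Rightarrow> real" where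
  "ip \<pi> f g = (\<Sum>x\<in>UNIV. \<pi> x * f $ x * g $ x)"

definition wnorm :: "('a::finite \<Rightarrow> real) \<Rightarrow> real ^ 'a \<Rightarrow> real" where
  "wnorm \<pi> f = sqrt (ip \<pi> f f)"

definition mean_zero :: "('a::finite \<Rightarrow> real) \<Rightarrow> (real ^ 'a) set" where
  "mean_zero \<pi> = {f. (\<Sum>x\<in>UNIV. \<pi> x * f $ x) = 0}"

definition onb :: "('a::finite \<Rightarrow> real) \<Rightarrow> nat \<Rightarrow> (real ^ 'a) set \<Rightarrow> (nat \<Rightarrow> real ^ 'a) \<Rightarrow> bool" where
  "onb \<pi> d S u \<longleftrightarrow>
     (\<forall>i\<in>{1..d}. \<forall>j\<in>{1..d}. ip \<pi> (u i) (u j) = (if i = j then 1 else 0)) \<and>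
     span (u ` {1..d}) = S"

definition orth_proj :: "('a::finite \<Rightarrow> real) \<Rightarrow> (real ^ 'a) set \<Rightarrow> real ^ 'a ^ 'a" where
  "orth_proj \<pi> S = (THE E. \<forall>f. E *v f \<in> S \<and> (\<forall>g\<in>S. ip \<pi> (f - E *v f) g = 0))"

definition wadjoint :: "('a::finite \<Rightarrow> real) \<Rightarrow> real ^ 'a ^ 'a \<Rightarrow> real ^ 'a ^ 'a" where
  "wadjoint \<pi> A = (\<chi> x y. \<pi> y * A $ y $ x / \<pi> x)"

definition frob_norm :: "('a::finite \<Rightarrow> real) \<Rightarrow> real ^ 'a ^ 'a \<Rightarrow> real" where
  "frob_norm \<pi> A = sqrt (trace (wadjoint \<pi> A ** A))"


section \<open>Markov kernels\<close>

definition markov_kernel :: "real ^ 'a ^ 'a::finite \<Rightarrow> bool" where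
  "markov_kernel P \<longleftrightarrow> (\<forall>x y. 0 \<le> P $ x $ y) \<and> (\<forall>x. (\<Sum>y\<in>UNIV. P $ x $ y) = 1)"

(* The power operation ^ and the product * on real ^ 'a ^ 'a are not matrix operations. *)
primrec kernel_pow :: "real ^ 'a ^ 'a::finite \<Rightarrow> nat \<Rightarrow> real ^ 'a ^ 'a" where
  "kernel_pow P 0 = Finite_Cartesian_Product.mat 1"
| "kernel_pow P (Suc m) = P ** kernel_pow P m"

definition irreducible_kernel :: "real ^ 'a ^ 'a::finite \<Rightarrow> bool" where
  "irreducible_kernel P \<longleftrightarrow> (\<forall>x y. \<exists>m. 0 < kernel_pow P m $ x $ y)"

definition aperiodic_kernel :: "real ^ 'a ^ 'a::finite \<Rightarrow> bool" where
  "aperiodic_kernel P \<longleftrightarrow> (\<forall>x. Gcd {m. 1 \<le> m \<and> 0 < kernel_pow P m $ x $ x} = 1)"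

definition ergodic_kernel :: "real ^ 'a ^ 'a::finite \<Rightarrow> bool" where
  "ergodic_kernel P \<longleftrightarrow> irreducible_kernel P \<and> aperiodic_kernel P"

definition reversible_kernel :: "('a::finite \<Rightarrow> real) \<Rightarrow> real ^ 'a ^ 'a \<Rightarrow> bool" where
  "reversible_kernel \<pi> P \<longleftrightarrow> (\<forall>x y. \<pi> x * P $ x $ y = \<pi> y * P $ y $ x)"

(* An ordered eigenbasis of P^2 on the mean-zero functions; since it is a basis, \<eta> lists the
   eigenvalues with multiplicity. The bounds 0 \<le> \<eta> j < 1 are not required: they follow from
   reversibility and ergodicity of P. *)
definition sq_eigenbasis ::
    "('a::finite \<Rightarrow> real) \<Rightarrow> real ^ 'a ^ 'a \<Rightarrow> (nat \<Rightarrow> real) \<Rightarrow> (nat \<Rightarrow> real ^ 'a) \<Rightarrow> bool" where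
  "sq_eigenbasis \<pi> P \<eta> \<phi> \<longleftrightarrow>
     onb \<pi> (CARD('a) - 1) (mean_zero \<pi>) \<phi> \<and>
     mono_on {1..CARD('a) - 1} \<eta> \<and>
     (\<forall>j\<in>{1..CARD('a) - 1}. (P ** P) *v \<phi> j = \<eta> j *\<^sub>R \<phi> j \<and> (\<exists>c. P *v \<phi> j = c *\<^sub>R \<phi> j))"


section \<open>Partitions\<close>

definition mean_kernel :: "('a::finite \<Rightarrow> real) \<Rightarrow> real ^ 'a ^ 'a" where
  "mean_kernel \<pi> = (\<chi> x y. \<pi> y)"

definition gibbs_kernel :: "('a::finite \<Rightarrow> real) \<Rightarrow> 'a set set \<Rightarrow> real ^ 'a ^ 'a" where
  "gibbs_kernel \<pi> \<O> = (\<chi> x y. \<Sum>B\<in>\<O>. indicator B x * indicator B y * \<pi> y / sum \<pi> B)"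

definition Q_kernel :: "('a::finite \<Rightarrow> real) \<Rightarrow> 'a set set \<Rightarrow> real ^ 'a ^ 'a" where
  "Q_kernel \<pi> \<O> = gibbs_kernel \<pi> \<O> - mean_kernel \<pi>"

definition V_space :: "('a::finite \<Rightarrow> real) \<Rightarrow> 'a set set \<Rightarrow> (real ^ 'a) set" where
  "V_space \<pi> \<O> = range ((*v) (Q_kernel \<pi> \<O>))"

definition delta ::
    "('a::finite \<Rightarrow> real) \<Rightarrow> (nat \<Rightarrow> real ^ 'a) \<Rightarrow> nat \<Rightarrow> 'a set set \<Rightarrow> real" where
  "delta \<pi> \<phi> d \<O> =
     (\<Sum>j=1..d. (wnorm \<pi> ((Finite_Cartesian_Product.mat 1 - gibbs_kernel \<pi> \<O>) *v \<phi> j))\<^sup>2)"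

(* Points of R^d are functions nat \<Rightarrow> real read on the coordinates 1, ..., d. *)
definition spectral_embedding :: "(nat \<Rightarrow> real ^ 'a::finite) \<Rightarrow> 'a \<Rightarrow> nat \<Rightarrow> real" where
  "spectral_embedding \<phi> x = (\<lambda>j. \<phi> j $ x)"

definition centroid :: "('a::finite \<Rightarrow> real) \<Rightarrow> ('a \<Rightarrow> nat \<Rightarrow> real) \<Rightarrow> 'a set \<Rightarrow> nat \<Rightarrow> real" where
  "centroid \<pi> \<Phi> B = (\<lambda>j. (1 / sum \<pi> B) * (\<Sum>x\<in>B. \<pi> x * \<Phi> x j))"


section \<open>Principal angles\<close>

definition cross_gram ::
    "('a::finite \<Rightarrow> real) \<Rightarrow> nat \<Rightarrow> (nat \<Rightarrow> real ^ 'a) \<Rightarrow> (nat \<Rightarrow> real ^ 'a) \<Rightarrow> real Matrix.mat" where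
  "cross_gram \<pi> d u v = Matrix.mat d d (\<lambda>(i, j). ip \<pi> (u (Suc i)) (v (Suc j)))"

(* For a d by d matrix A: \<sigma> 1, ..., \<sigma> d are the nonnegative square roots of the eigenvalues of
   transpose(A) * A, the latter counted with multiplicity (as roots of the characteristic
   polynomial), in arbitrary order. *)
definition singular_values :: "nat \<Rightarrow> real Matrix.mat \<Rightarrow> (nat \<Rightarrow> real) \<Rightarrow> bool" where
  "singular_values d A \<sigma> \<longleftrightarrow> A \<in> carrier_mat d d \<and> (\<forall>j\<in>{1..d}. 0 \<le> \<sigma> j) \<and>
     char_poly (transpose_mat A * A) = (\<Prod>j=1..d. [:- ((\<sigma> j)\<^sup>2), 1:])"

(* The singular values do not depend on the orthonormal bases chosen. *)
definition principal_angles ::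
    "('a::finite \<Rightarrow> real) \<Rightarrow> nat \<Rightarrow> (real ^ 'a) set \<Rightarrow> (real ^ 'a) set \<Rightarrow> (nat \<Rightarrow> real) \<Rightarrow> bool" where
  "principal_angles \<pi> d U V \<theta> \<longleftrightarrow>
     (\<forall>j\<in>{1..d}. 0 \<le> \<theta> j \<and> \<theta> j \<le> pi / 2) \<and>
     (\<exists>u v. onb \<pi> d U u \<and> onb \<pi> d V v \<and>
            singular_values d (cross_gram \<pi> d u v) (\<lambda>j. cos (\<theta> j)))"


section \<open>The adjoint and the projection are the intended ones\<close>

lemma wadjoint_ip:
  assumes "prob_weights \<pi>"
  shows "ip \<pi> (A *v f) g = ip \<pi> f (wadjoint \<pi> A *v g)"
proof -
  have pos: "\<pi> x \<noteq> 0" for x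
    using assms by (metis less_irrefl prob_weights_def)
  have "ip \<pi> f (wadjoint \<pi> A *v g) = (\<Sum>x\<in>UNIV. \<Sum>y\<in>UNIV. \<pi> y * A $ y $ x * f $ x * g $ y)"
    using pos
    by (simp add: ip_def wadjoint_def matrix_vector_mult_def sum_distrib_left mult_ac)
  also have "\<dots> = (\<Sum>y\<in>UNIV. \<Sum>x\<in>UNIV. \<pi> y * A $ y $ x * f $ x * g $ y)"
    by (rule sum.swap)
  also have "\<dots> = ip \<pi> (A *v f) g"
    by (simp add: ip_def matrix_vector_mult_def sum_distrib_left sum_distrib_right mult_ac)
  finally show ?thesis by simp
qed

lemma ip_diff_left: "ip \<pi> (f - g) h = ip \<pi> f h - ip \<pi> g h"
  by (simp add: ip_def algebra_simps sum_subtractf)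

lemma orth_proj_onb:
  assumes "prob_weights \<pi>" and "onb \<pi> d S u"
  shows "orth_proj \<pi> S = (\<chi> x y. \<Sum>j=1..d. u j $ x * (u j $ y * \<pi> y))" (is "_ = ?E")
    and "orth_proj \<pi> S *v f \<in> S"
    and "g \<in> S \<Longrightarrow> ip \<pi> (f - orth_proj \<pi> S *v f) g = 0"
proof -
  have S: "span (u ` {1..d}) = S"
    and on: "\<And>i j. i \<in> {1..d} \<Longrightarrow> j \<in> {1..d} \<Longrightarrow> ip \<pi> (u i) (u j) = (if i = j then 1 else 0)"
    using assms(2) by (auto simp: onb_def)
  have E: "?E *v f = (\<Sum>j=1..d. ip \<pi> f (u j) *\<^sub>R u j)" for f
  proof -
    have "(?E *v f) $ x = (\<Sum>y\<in>UNIV. \<Sum>j=1..d. \<pi> y * f $ y * u j $ y * u j $ x)" for x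
      by (simp add: matrix_vector_mult_def sum_distrib_left sum_distrib_right mult_ac)
    also have "\<dots> x = (\<Sum>j=1..d. \<Sum>y\<in>UNIV. \<pi> y * f $ y * u j $ y * u j $ x)" for x
      by (rule sum.swap)
    finally show ?thesis
      by (simp add: vec_eq_iff ip_def sum_distrib_left sum_distrib_right mult_ac)
  qed
  have ES: "?E *v f \<in> S" for f
    unfolding E S[symmetric] by (intro span_sum span_scale span_base) auto
  have lin: "ip \<pi> (\<Sum>j=1..d. c j *\<^sub>R u j) h = (\<Sum>j=1..d. c j * ip \<pi> (u j) h)" for c h
  proof -
    have "ip \<pi> (\<Sum>j=1..d. c j *\<^sub>R u j) h
        = (\<Sum>x\<in>UNIV. \<Sum>j=1..d. c j * (\<pi> x * u j $ x * h $ x))"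
      by (simp add: ip_def sum_distrib_left sum_distrib_right mult_ac)
    also have "\<dots> = (\<Sum>j=1..d. \<Sum>x\<in>UNIV. c j * (\<pi> x * u j $ x * h $ x))"
      by (rule sum.swap)
    finally show ?thesis by (simp add: ip_def sum_distrib_left)
  qed
  have ub: "ip \<pi> (f - ?E *v f) (u i) = 0" if "i \<in> {1..d}" for f i
  proof -
    have "(\<Sum>j=1..d. ip \<pi> f (u j) * ip \<pi> (u j) (u i))
        = (\<Sum>j=1..d. if j = i then ip \<pi> f (u i) else 0)"
      using that by (intro sum.cong) (auto simp: on)
    then show ?thesis using that unfolding ip_diff_left E lin by simp
  qed
  have sub: "subspace {g. ip \<pi> h g = 0}" for h
    by (auto simp: subspace_def ip_def algebra_simps sum.distrib sum_distrib_left[symmetric])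
  have EO: "ip \<pi> (f - ?E *v f) g = 0" if "g \<in> S" for f g
  proof -
    have "u ` {1..d} \<subseteq> {g. ip \<pi> (f - ?E *v f) g = 0}" using ub by blast
    from span_minimal[OF this sub] that S show ?thesis by blast
  qed
  have def0: "f = 0" if "ip \<pi> f f = 0" for f
  proof -
    have "\<forall>x\<in>UNIV. \<pi> x * f $ x * f $ x = 0"
      using that assms(1) unfolding ip_def prob_weights_def
      by (subst (asm) sum_nonneg_eq_0_iff) (auto simp: mult.assoc less_imp_le)
    moreover have "\<pi> x \<noteq> 0" for x
      using assms(1) by (metis less_irrefl prob_weights_def)
    ultimately show ?thesis by (simp add: vec_eq_iff)
  qed
  have uniq: "E' = ?E" if h: "\<forall>f. E' *v f \<in> S \<and> (\<forall>g\<in>S. ip \<pi> (f - E' *v f) g = 0)" for E'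
  proof -
    have "E' *v f = ?E *v f" for f
    proof -
      let ?d = "E' *v f - ?E *v f"
      have "?d \<in> S" unfolding S[symmetric]
        by (rule span_diff) (use h ES S in blast)+
      then have "ip \<pi> (f - E' *v f) ?d = 0" and "ip \<pi> (f - ?E *v f) ?d = 0"
        using h EO by blast+
      then have "ip \<pi> ?d ?d = 0" unfolding ip_diff_left by linarith
      from def0[OF this] show ?thesis by simp
    qed
    then show ?thesis unfolding matrix_eq by blast
  qed
  show eq: "orth_proj \<pi> S = ?E"
    unfolding orth_proj_def by (rule the_equality) (use ES EO uniq in blast)+
  show "orth_proj \<pi> S *v f \<in> S" "g \<in> S \<Longrightarrow> ip \<pi> (f - orth_proj \<pi> S *v f) g = 0"
    unfolding eq using ES EO by blast+
qed

end

(* E (the projection onto U) and Q are both orthogonal projectors of trace d = k - 1, so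
   |E - Q|^2 = tr E + tr Q - 2 tr (E Q) = 2 (d - tr (E Q)).  In the basis phi,
   d - tr (E Q) = sum_j (1 - <phi_j, Q phi_j>), and by Pythagoras the j-th term is the squared norm
   of (I - G) phi_j, since Q = G on mean-zero functions.  In orthonormal bases u, v of the two
   subspaces, tr (E Q) = sum_ij <u_i, v_j>^2 = tr (C^T C) for the cross-Gram matrix C, and this is
   the sum of the squared cosines of the principal angles. *)

theory Submission
  imports Defs "Jordan_Normal_Form.Schur_Decomposition"
begin

no_notation Matrix.vec_index (infixl "$" 100)

section \<open>Traces, eigenvalues and singular values of square matrices\<close>

lemma sum_diag_mult_commute:
  fixes A B :: "'a::comm_semiring_0 Matrix.mat"
  assumes "A \<in> carrier_mat n n" and "B \<in> carrier_mat n n"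
  shows "(\<Sum>i<n. (A * B) $$ (i, i)) = (\<Sum>i<n. (B * A) $$ (i, i))"
proof -
  have *: "(\<Sum>i<n. (C * D) $$ (i, i)) = (\<Sum>i<n. \<Sum>j<n. C $$ (i, j) * D $$ (j, i))"
    if "C \<in> carrier_mat n n" "D \<in> carrier_mat n n" for C D :: "'a Matrix.mat"
    using that by (intro sum.cong refl) (auto simp: scalar_prod_def atLeast0LessThan)
  show ?thesis
    unfolding *[OF assms] *[OF assms(2,1)]
    by (subst sum.swap) (simp add: mult.commute)
qed

text \<open>Schur triangularisation makes \<open>A\<close> similar to a matrix with diagonal
  \<open>es\<close>, and the sum of the diagonal is invariant under similarity.\<close>

lemma sum_diag_eq_sum_roots_char_poly:
  fixes A :: "'a::conjugatable_ordered_field Matrix.mat"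
  assumes A: "A \<in> carrier_mat n n"
    and cp: "char_poly A = (\<Prod>e\<leftarrow>es. [:- e, 1:])"
  shows "(\<Sum>i<n. A $$ (i, i)) = sum_list es"
proof -
  obtain B P Q where "schur_decomposition A es = (B, P, Q)"
    by (cases "schur_decomposition A es") auto
  from schur_decomposition[OF A cp this]
  have sim: "similar_mat_wit A B P Q" and diag: "diag_mat B = es" by auto
  note w = similar_mat_witD2[OF A sim]
  have "(\<Sum>i<n. A $$ (i, i)) = (\<Sum>i<n. (P * (B * Q)) $$ (i, i))"
    using w by (simp add: assoc_mult_mat[of P n n B n Q n])
  also have "\<dots> = (\<Sum>i<n. (B * Q * P) $$ (i, i))"
    by (rule sum_diag_mult_commute) (use w in auto)
  also have "B * Q * P = B"
    using w by (simp add: assoc_mult_mat[of B n n Q n P n])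
  also have "(\<Sum>i<n. B $$ (i, i)) = sum_list (diag_mat B)"
    using w by (simp add: diag_mat_def sum_list_sum_nth atLeast0LessThan)
  finally show ?thesis by (simp add: diag)
qed

text \<open>Both sides are the trace of \<open>transpose_mat A * A\<close>, once as the sum of its
  eigenvalues and once entry by entry.\<close>

lemma singular_values_sum_squares:
  assumes "singular_values d A \<sigma>"
  shows "(\<Sum>j=1..d. (\<sigma> j)\<^sup>2) = (\<Sum>i<d. \<Sum>j<d. (A $$ (i, j))\<^sup>2)"
proof -
  have A: "A \<in> carrier_mat d d"
    and cp: "char_poly (transpose_mat A * A) = (\<Prod>j=1..d. [:- ((\<sigma> j)\<^sup>2), 1:])"
    using assms by (auto simp: singular_values_def)
  let ?es = "map (\<lambda>j. (\<sigma> j)\<^sup>2) [1..<Suc d]"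
  have "char_poly (transpose_mat A * A) = (\<Prod>e\<leftarrow>?es. [:- e, 1:])"
    unfolding cp
    by (simp add: prod.distinct_set_conv_list[symmetric] atLeastLessThanSuc_atLeastAtMost comp_def
        del: upt_Suc)
  then have "(\<Sum>i<d. (transpose_mat A * A) $$ (i, i)) = sum_list ?es"
    using A by (intro sum_diag_eq_sum_roots_char_poly) auto
  also have "\<dots> = (\<Sum>j=1..d. (\<sigma> j)\<^sup>2)"
    by (simp add: sum.distinct_set_conv_list[symmetric] atLeastLessThanSuc_atLeastAtMost
        del: upt_Suc)
  also have "(\<Sum>i<d. (transpose_mat A * A) $$ (i, i)) = (\<Sum>i<d. \<Sum>j<d. (A $$ (j, i))\<^sup>2)"
    using A by (intro sum.cong refl)
      (auto simp: scalar_prod_def atLeast0LessThan power2_eq_square)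
  \<comment> \<open>The diagonal of \<open>transpose_mat A * A\<close> yields the squares column by
    column, while the goal lists them row by row.\<close>
  finally show ?thesis by (subst (asm) sum.swap) simp
qed

section \<open>Weighted inner product, adjoint and Frobenius norm\<close>

lemma prob_weights_pos: "prob_weights \<pi> \<Longrightarrow> 0 < \<pi> x"
  by (simp add: prob_weights_def)

lemma prob_weights_nonzero: "prob_weights \<pi> \<Longrightarrow> \<pi> x \<noteq> 0"
  using prob_weights_pos[of \<pi> x] by linarith

lemma ip_commute: "ip \<pi> f g = ip \<pi> g f"
  by (simp add: ip_def mult_ac)

lemma ip_diff_right: "ip \<pi> f (g - h) = ip \<pi> f g - ip \<pi> f h"
  by (simp add: ip_def algebra_simps sum_subtractf)

lemma ip_self_nonneg: "prob_weights \<pi> \<Longrightarrow> 0 \<le> ip \<pi> f f"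
  unfolding ip_def by (intro sum_nonneg) (simp add: prob_weights_def less_imp_le mult.assoc)

lemma ip_self_eq_0D:
  assumes "prob_weights \<pi>" and "ip \<pi> f f = 0"
  shows "f = 0"
proof -
  have "\<forall>x\<in>UNIV. \<pi> x * f $ x * f $ x = 0"
    using assms unfolding ip_def prob_weights_def
    by (subst (asm) sum_nonneg_eq_0_iff) (auto simp: mult.assoc less_imp_le)
  then show ?thesis
    using prob_weights_nonzero[OF assms(1)] by (simp add: vec_eq_iff)
qed

lemma wnorm_power2: "prob_weights \<pi> \<Longrightarrow> (wnorm \<pi> f)\<^sup>2 = ip \<pi> f f"
  by (simp add: wnorm_def ip_self_nonneg)

lemma wadjoint_diff: "wadjoint \<pi> (A - B) = wadjoint \<pi> A - wadjoint \<pi> B"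
  by (simp add: wadjoint_def vec_eq_iff algebra_simps diff_divide_distrib)

lemma wadjoint_mult:
  assumes "prob_weights \<pi>"
  shows "wadjoint \<pi> (A ** B) = wadjoint \<pi> B ** wadjoint \<pi> A"
  using prob_weights_nonzero[OF assms]
  by (simp add: wadjoint_def matrix_matrix_mult_def vec_eq_iff sum_distrib_left
      sum_divide_distrib mult_ac)

lemma frob_norm_power2:
  assumes "prob_weights \<pi>"
  shows "(frob_norm \<pi> A)\<^sup>2 = trace (wadjoint \<pi> A ** A)"
proof -
  \<comment> \<open>The trace is the sum of \<pi>(y) A(y,x)^2 / \<pi>(x); its sign is what lets the
    square cancel the root in \<open>frob_norm\<close>.\<close>
  have "0 \<le> trace (wadjoint \<pi> A ** A)"
    unfolding trace_def matrix_matrix_mult_def wadjoint_def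
    using prob_weights_pos[OF assms]
    by (auto intro!: sum_nonneg simp: mult.assoc less_imp_le divide_nonneg_pos)
  then show ?thesis by (simp add: frob_norm_def)
qed

section \<open>Orthogonal projectors of the weighted space, their traces and quadratic forms\<close>

definition orth_projector :: "('a::finite \<Rightarrow> real) \<Rightarrow> real ^ 'a ^ 'a \<Rightarrow> bool" where
  "orth_projector \<pi> A \<longleftrightarrow> wadjoint \<pi> A = A \<and> A ** A = A"

text \<open>The difference is self-adjoint, so its squared norm is the trace of its square, and
  \<open>A ** B\<close> and \<open>B ** A\<close> have equal traces.\<close>

lemma frob_norm_diff_projectors:
  assumes "prob_weights \<pi>" and "orth_projector \<pi> A" and "orth_projector \<pi> B"
  shows "(frob_norm \<pi> (A - B))\<^sup>2 = trace A + trace B - 2 * trace (A ** B)"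
proof -
  have "(A - B) ** (A - B) = (A ** A - A ** B) - (B ** A - B ** B)"
    by (simp add: matrix_matrix_mult_def vec_eq_iff algebra_simps sum_subtractf sum.distrib)
  then show ?thesis
    using assms(2,3) trace_mul_sym[of B A]
    by (simp add: frob_norm_power2[OF assms(1)] wadjoint_diff orth_projector_def trace_sub)
qed

text \<open>Here a projector is given, where \<open>orth_proj_onb\<close> starts from an orthonormal
  basis. The lemma identifies \<open>Q_kernel\<close> with the projection onto
  \<open>V_space\<close>.\<close>

lemma orth_proj_range_projector:
  assumes "prob_weights \<pi>" and "orth_projector \<pi> A"
  shows "orth_proj \<pi> (range ((*v) A)) = A"
  unfolding orth_proj_def
proof (rule the_equality)
  have adj: "wadjoint \<pi> A = A" and idem: "A ** A = A"
    using assms(2) by (auto simp: orth_projector_def)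
  \<comment> \<open>Moving \<open>A\<close> to the left argument by self-adjointness leaves A f - A
    (A f), which is 0.\<close>
  have orth: "ip \<pi> (f - A *v f) (A *v g) = 0" for f g
    using wadjoint_ip[OF assms(1), of A "f - A *v f" g] idem
    by (simp add: adj matrix_vector_mult_diff_distrib matrix_vector_mul_assoc ip_def)
  then show "\<forall>f. A *v f \<in> range ((*v) A) \<and> (\<forall>g\<in>range ((*v) A). ip \<pi> (f - A *v f) g = 0)"
    by auto
  fix E
  assume E: "\<forall>f. E *v f \<in> range ((*v) A) \<and> (\<forall>g\<in>range ((*v) A). ip \<pi> (f - E *v f) g = 0)"
  have "E *v f = A *v f" for f
  proof -
    \<comment> \<open>\<open>?d\<close> lies in the range of \<open>A\<close> and is orthogonal to
      both residuals, hence to their difference, which is \<open>?d\<close> itself.\<close>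
    let ?d = "E *v f - A *v f"
    obtain h where "E *v f = A *v h" using E by blast
    then have d: "?d = A *v (h - f)" by (simp add: matrix_vector_mult_diff_distrib)
    then have "ip \<pi> (f - E *v f) ?d = 0" and "ip \<pi> (f - A *v f) ?d = 0"
      using E orth by auto
    then have "ip \<pi> ?d ?d = 0" unfolding ip_diff_left by linarith
    then show ?thesis using ip_self_eq_0D[OF assms(1)] by fastforce
  qed
  then show "E = A" unfolding matrix_eq by blast
qed

text \<open>The residual of a vector already in \<open>S\<close> lies in \<open>S\<close> and is
  orthogonal to \<open>S\<close>, hence vanishes: this is idempotence. Self-adjointness is read off
  the explicit matrix, symmetric up to the factor \<pi>(y).\<close>

lemma projector_orth_proj:
  assumes "prob_weights \<pi>" and "onb \<pi> d S u"
  shows "orth_projector \<pi> (orth_proj \<pi> S)"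
proof -
  let ?E = "orth_proj \<pi> S"
  note E = orth_proj_onb[OF assms]
  have S: "span (u ` {1..d}) = S" using assms(2) by (simp add: onb_def)
  have "?E *v (?E *v f) = ?E *v f" for f
  proof -
    let ?d = "?E *v f - ?E *v (?E *v f)"
    have "?d \<in> S" using span_diff[of _ "u ` {1..d}"] E(2) unfolding S by blast
    then have "ip \<pi> ?d ?d = 0" by (rule E(3))
    then show ?thesis using ip_self_eq_0D[OF assms(1)] by fastforce
  qed
  then have "?E ** ?E = ?E" unfolding matrix_eq by (simp add: matrix_vector_mul_assoc)
  moreover have "wadjoint \<pi> ?E = ?E"
    unfolding E(1) using prob_weights_nonzero[OF assms(1)]
    by (simp add: wadjoint_def vec_eq_iff sum_distrib_left sum_divide_distrib mult_ac)
  ultimately show ?thesis by (simp add: orth_projector_def)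
qed

text \<open>The projection is the sum of the rank-one operators sending f to <f, u_j> u_j. Taking
  the identity for \<open>A\<close> yields the dimension, taking \<open>Q_kernel\<close> the overlap
  of the two subspaces.\<close>

lemma trace_orth_proj_mult:
  assumes "prob_weights \<pi>" and "onb \<pi> d S u"
  shows "trace (orth_proj \<pi> S ** A) = (\<Sum>j=1..d. ip \<pi> (u j) (A *v u j))"
proof -
  have "trace (orth_proj \<pi> S ** A)
      = (\<Sum>x\<in>UNIV. \<Sum>y\<in>UNIV. \<Sum>j=1..d. \<pi> y * u j $ y * A $ y $ x * u j $ x)"
    by (simp add: orth_proj_onb(1)[OF assms] trace_def matrix_matrix_mult_def
        sum_distrib_left sum_distrib_right mult_ac)
  also have "\<dots> = (\<Sum>j=1..d. \<Sum>x\<in>UNIV. \<Sum>y\<in>UNIV. \<pi> y * u j $ y * A $ y $ x * u j $ x)"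
    \<comment> \<open>Occurrence 2 is the inner pair, so \<open>j\<close> moves first past
      \<open>y\<close> and then past \<open>x\<close>.\<close>
    by (subst (2) sum.swap, subst sum.swap) (rule refl)
  also have "\<dots> = (\<Sum>j=1..d. \<Sum>y\<in>UNIV. \<Sum>x\<in>UNIV. \<pi> y * u j $ y * A $ y $ x * u j $ x)"
    by (intro sum.cong refl sum.swap)
  also have "\<dots> = (\<Sum>j=1..d. ip \<pi> (u j) (A *v u j))"
    by (simp add: ip_def matrix_vector_mult_def sum_distrib_left mult_ac)
  finally show ?thesis .
qed

lemma trace_orth_proj:
  assumes "prob_weights \<pi>" and "onb \<pi> d S u"
  shows "trace (orth_proj \<pi> S) = d"
  using trace_orth_proj_mult[OF assms, of "Finite_Cartesian_Product.mat 1"] assms(2)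
  by (simp add: onb_def)

text \<open>Parseval for the projection. For a basis vector of the other subspace the right-hand
  side is a row of squared cross-Gram entries.\<close>

lemma ip_orth_proj_self:
  assumes "prob_weights \<pi>" and "onb \<pi> d S u"
  shows "ip \<pi> f (orth_proj \<pi> S *v f) = (\<Sum>j=1..d. (ip \<pi> f (u j))\<^sup>2)"
proof -
  have "ip \<pi> f (orth_proj \<pi> S *v f)
      = (\<Sum>x\<in>UNIV. \<Sum>y\<in>UNIV. \<Sum>j=1..d. (\<pi> x * f $ x * u j $ x) * (\<pi> y * f $ y * u j $ y))"
    by (simp add: orth_proj_onb(1)[OF assms] ip_def matrix_vector_mult_def
        sum_distrib_left sum_distrib_right mult_ac)
  also have "\<dots> = (\<Sum>j=1..d. \<Sum>x\<in>UNIV. \<Sum>y\<in>UNIV. (\<pi> x * f $ x * u j $ x) * (\<pi> y * f $ y * u j $ y))"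
    by (subst (2) sum.swap, subst sum.swap) (rule refl)
  also have "\<dots> = (\<Sum>j=1..d. (ip \<pi> f (u j))\<^sup>2)"
    by (simp add: ip_def power2_eq_square sum_product)
  finally show ?thesis .
qed

lemma onb_span_initial:
  assumes "onb \<pi> n S u" and "d \<le> n"
  shows "onb \<pi> d (span (u ` {1..d})) u"
  using assms by (auto simp: onb_def)

section \<open>The Gibbs kernel of a partition and the projector \<open>Q_kernel\<close>\<close>

lemma block_weight_pos:
  assumes "prob_weights \<pi>" and "partition_on UNIV \<O>" and "B \<in> \<O>"
  shows "0 < sum \<pi> B"
  using assms partition_onD3[OF assms(2)] prob_weights_pos[OF assms(1)]
  by (intro sum_pos) auto

text \<open>Blocks are disjoint, so a single term survives; this collapses the sum in
  \<open>gibbs_kernel\<close>.\<close>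

lemma partition_sum_indicator:
  fixes h :: "'a::finite set \<Rightarrow> real"
  assumes "partition_on UNIV \<O>" and "B \<in> \<O>" and "x \<in> B"
  shows "(\<Sum>C\<in>\<O>. indicator C x * h C) = h B"
proof -
  have "(\<Sum>C\<in>\<O>. indicator C x * h C) = (\<Sum>C\<in>\<O>. if C = B then h B else 0)"
    using partition_onD2[OF assms(1)] assms(2,3)
    by (intro sum.cong) (auto simp: indicator_def dest: disjointD)
  then show ?thesis using assms(2) by simp
qed

lemma sum_partition_UNIV:
  fixes f :: "'a::finite \<Rightarrow> real"
  assumes "partition_on UNIV \<O>"
  shows "(\<Sum>B\<in>\<O>. \<Sum>x\<in>B. f x) = (\<Sum>x\<in>UNIV. f x)"
  using sum.partition[OF finite assms, of f] by simp

lemma sum_UNIV_indicator_mult: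
  fixes f :: "'a::finite \<Rightarrow> real"
  shows "(\<Sum>x\<in>UNIV. indicator B x * f x) = sum f B"
  by (simp add: sum_indicator_mult)

lemma gibbs_kernel_apply:
  assumes "partition_on UNIV \<O>" and "B \<in> \<O>" and "x \<in> B"
  shows "(gibbs_kernel \<pi> \<O> *v f) $ x = (\<Sum>y\<in>B. \<pi> y * f $ y) / sum \<pi> B"
proof -
  have "(gibbs_kernel \<pi> \<O> *v f) $ x
      = (\<Sum>y\<in>UNIV. indicator B y * (\<pi> y * f $ y) / sum \<pi> B)"
  proof -
    have "(\<Sum>C\<in>\<O>. indicator C x * indicator C y * \<pi> y / sum \<pi> C)
        = indicator B y * \<pi> y / sum \<pi> B" for y
      using partition_sum_indicator[OF assms, of "\<lambda>C. indicator C y * \<pi> y / sum \<pi> C"]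
      by (simp add: mult.assoc)
    then show ?thesis by (simp add: gibbs_kernel_def matrix_vector_mult_def mult.assoc)
  qed
  also have "\<dots> = (\<Sum>y\<in>B. \<pi> y * f $ y) / sum \<pi> B"
    by (simp add: sum_UNIV_indicator_mult flip: sum_divide_distrib)
  finally show ?thesis .
qed

text \<open>Detailed balance holds for each block separately, as \<pi>(x) \<pi>(y) / \<pi>(B) is
  symmetric in x and y.\<close>

lemma wadjoint_gibbs_kernel:
  assumes "prob_weights \<pi>"
  shows "wadjoint \<pi> (gibbs_kernel \<pi> \<O>) = gibbs_kernel \<pi> \<O>"
proof -
  have "\<pi> y * (\<Sum>B\<in>\<O>. indicator B y * indicator B x * \<pi> x / sum \<pi> B) / \<pi> x
      = (\<Sum>B\<in>\<O>. indicator B x * indicator B y * \<pi> y / sum \<pi> B)" for x y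
    unfolding sum_distrib_left[of "\<pi> y"] sum_divide_distrib[of _ _ "\<pi> x"]
    using prob_weights_nonzero[OF assms, of x] by (intro sum.cong) (auto simp: indicator_def)
  then show ?thesis by (simp add: wadjoint_def gibbs_kernel_def vec_eq_iff)
qed

lemma wadjoint_mean_kernel: "prob_weights \<pi> \<Longrightarrow> wadjoint \<pi> (mean_kernel \<pi>) = mean_kernel \<pi>"
  using prob_weights_nonzero[of \<pi>] by (simp add: wadjoint_def mean_kernel_def vec_eq_iff)

text \<open>Serves twice: applied to an image of the Gibbs kernel it gives idempotence, applied to
  constants it gives that the kernel fixes the range of \<open>mean_kernel\<close>.\<close>

lemma gibbs_kernel_fix:
  assumes "prob_weights \<pi>" and "partition_on UNIV \<O>"
    and "\<And>B x y. B \<in> \<O> \<Longrightarrow> x \<in> B \<Longrightarrow> y \<in> B \<Longrightarrow> f $ x = f $ y"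
  shows "gibbs_kernel \<pi> \<O> *v f = f"
proof -
  have "(gibbs_kernel \<pi> \<O> *v f) $ x = f $ x" for x
  proof -
    obtain B where B: "B \<in> \<O>" "x \<in> B" using partition_onD1[OF assms(2)] by blast
    have "(\<Sum>y\<in>B. \<pi> y * f $ y) = sum \<pi> B * f $ x"
      unfolding sum_distrib_right using assms(3)[OF B(1) _ B(2)] by (intro sum.cong) auto
    then show ?thesis
      using block_weight_pos[OF assms(1,2) B(1)] by (simp add: gibbs_kernel_apply[OF assms(2) B])
  qed
  then show ?thesis by (simp add: vec_eq_iff)
qed

lemma projector_gibbs_kernel:
  assumes "prob_weights \<pi>" and "partition_on UNIV \<O>"
  shows "orth_projector \<pi> (gibbs_kernel \<pi> \<O>)"
proof -
  have "gibbs_kernel \<pi> \<O> *v (gibbs_kernel \<pi> \<O> *v f) = gibbs_kernel \<pi> \<O> *v f" for f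
    by (rule gibbs_kernel_fix[OF assms]) (simp add: gibbs_kernel_apply[OF assms(2)])
  then show ?thesis
    unfolding orth_projector_def
    by (simp add: wadjoint_gibbs_kernel[OF assms(1)] matrix_eq matrix_vector_mul_assoc)
qed

lemma mean_kernel_apply: "mean_kernel \<pi> *v f = (\<chi> x. \<Sum>y\<in>UNIV. \<pi> y * f $ y)"
  by (simp add: mean_kernel_def matrix_vector_mult_def vec_eq_iff)

text \<open>The constants, onto which \<open>mean_kernel\<close> projects, lie in the range of the
  Gibbs kernel, and the difference of two nested orthogonal projectors is again one.\<close>

lemma projector_Q_kernel:
  assumes "prob_weights \<pi>" and "partition_on UNIV \<O>"
  shows "orth_projector \<pi> (Q_kernel \<pi> \<O>)"
proof -
  let ?G = "gibbs_kernel \<pi> \<O>" and ?M = "mean_kernel \<pi>"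
  have G: "wadjoint \<pi> ?G = ?G" "?G ** ?G = ?G"
    using projector_gibbs_kernel[OF assms] by (auto simp: orth_projector_def)
  have M: "wadjoint \<pi> ?M = ?M" by (rule wadjoint_mean_kernel[OF assms(1)])
  have "?G *v (?M *v f) = ?M *v f" for f
    by (rule gibbs_kernel_fix[OF assms]) (simp add: mean_kernel_apply)
  then have GM: "?G ** ?M = ?M" by (simp add: matrix_eq matrix_vector_mul_assoc)
  \<comment> \<open>Taking adjoints in \<open>GM\<close> reverses the order of the factors.\<close>
  then have MG: "?M ** ?G = ?M"
    using wadjoint_mult[OF assms(1), of ?G ?M] by (simp add: G M)
  have MM: "?M ** ?M = ?M"
    using assms(1)
    by (simp add: mean_kernel_def matrix_matrix_mult_def vec_eq_iff prob_weights_def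
        flip: sum_distrib_right)
  have "(?G - ?M) ** (?G - ?M) = (?G ** ?G - ?G ** ?M) - (?M ** ?G - ?M ** ?M)"
    by (simp add: matrix_matrix_mult_def vec_eq_iff algebra_simps sum_subtractf sum.distrib)
  then show ?thesis
    by (simp add: orth_projector_def Q_kernel_def wadjoint_diff G M GM MG MM)
qed

text \<open>Each block adds \<pi>(B) / \<pi>(B) = 1 to the trace of the Gibbs kernel, and the trace
  of \<open>mean_kernel\<close> is the total mass.\<close>

lemma trace_Q_kernel:
  assumes "prob_weights \<pi>" and "partition_on UNIV \<O>"
  shows "trace (Q_kernel \<pi> \<O>) = real (card \<O>) - 1"
proof -
  have "trace (gibbs_kernel \<pi> \<O>)
      = (\<Sum>B\<in>\<O>. \<Sum>x\<in>UNIV. indicator B x * indicator B x * \<pi> x / sum \<pi> B)"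
    unfolding trace_def gibbs_kernel_def by (simp add: sum.swap[of _ \<O>])
  also have "\<dots> = (\<Sum>B\<in>\<O>. sum \<pi> B / sum \<pi> B)"
    by (simp add: sum_UNIV_indicator_mult mult.assoc flip: sum_divide_distrib)
  also have "\<dots> = (\<Sum>B\<in>\<O>. 1)"
    using block_weight_pos[OF assms] by (intro sum.cong refl) (metis divide_self less_irrefl)
  finally have "trace (gibbs_kernel \<pi> \<O>) = card \<O>" by simp
  moreover have "trace (mean_kernel \<pi>) = 1"
    using assms(1) by (simp add: trace_def mean_kernel_def prob_weights_def)
  ultimately show ?thesis by (simp add: Q_kernel_def trace_sub)
qed

section \<open>Distortion, clustering cost, distance of projectors and principal angles\<close>

lemma wnorm_compl_gibbs:
  assumes "prob_weights \<pi>" and "partition_on UNIV \<O>" and "f \<in> mean_zero \<pi>"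
  shows "(wnorm \<pi> ((Finite_Cartesian_Product.mat 1 - gibbs_kernel \<pi> \<O>) *v f))\<^sup>2
       = ip \<pi> f f - ip \<pi> f (Q_kernel \<pi> \<O> *v f)"
proof -
  let ?G = "gibbs_kernel \<pi> \<O>"
  have "ip \<pi> (?G *v f) (?G *v f) = ip \<pi> f (?G *v f)"
    using wadjoint_ip[OF assms(1), of ?G f "?G *v f"] projector_gibbs_kernel[OF assms(1,2)]
    by (simp add: orth_projector_def matrix_vector_mul_assoc)
  \<comment> \<open>\<open>mean_kernel\<close> annihilates mean-zero functions.\<close>
  moreover have "Q_kernel \<pi> \<O> *v f = ?G *v f"
    using assms(3)
    by (simp add: Q_kernel_def matrix_vector_mult_diff_rdistrib mean_kernel_apply mean_zero_def
        vec_eq_iff)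
  ultimately show ?thesis
    by (simp add: wnorm_power2[OF assms(1)] matrix_vector_mult_diff_rdistrib ip_diff_left
        ip_diff_right ip_commute[of \<pi> "?G *v f" f])
qed

text \<open>By \<open>gibbs_kernel_apply\<close>, coordinate j of the centroid of \<open>B\<close>
  is the value of G phi_j on \<open>B\<close>. Both sides then sum the same squares, coordinate by
  coordinate or block by block.\<close>

lemma delta_eq_kmeans_cost:
  assumes "prob_weights \<pi>" and "partition_on UNIV \<O>"
  shows "delta \<pi> \<phi> d \<O> = (\<Sum>B\<in>\<O>. \<Sum>x\<in>B. \<pi> x *
    (L2_set (\<lambda>j. spectral_embedding \<phi> x j - centroid \<pi> (spectral_embedding \<phi>) B j) {1..d})\<^sup>2)"
    (is "_ = ?R")
proof -
  let ?G = "gibbs_kernel \<pi> \<O>"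
  have "?R = (\<Sum>B\<in>\<O>. \<Sum>x\<in>B. \<Sum>j=1..d. \<pi> x * (\<phi> j $ x - (?G *v \<phi> j) $ x)\<^sup>2)"
    by (intro sum.cong refl)
      (simp add: L2_set_def sum_nonneg spectral_embedding_def centroid_def
        gibbs_kernel_apply[OF assms(2)] sum_distrib_left[of "\<pi> _"])
  also have "\<dots> = (\<Sum>j=1..d. \<Sum>x\<in>UNIV. \<pi> x * (\<phi> j $ x - (?G *v \<phi> j) $ x)\<^sup>2)"
    unfolding sum_partition_UNIV[OF assms(2)] by (rule sum.swap)
  also have "\<dots> = delta \<pi> \<phi> d \<O>"
    unfolding delta_def wnorm_power2[OF assms(1)]
    by (simp add: ip_def matrix_vector_mult_diff_rdistrib power2_eq_square mult.assoc)
  finally show ?thesis by simp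
qed

text \<open>The left-hand side depends on \<open>U\<close> only, so the basis \<open>u\<close> may
  be chosen freely: the eigenfunctions lead to \<open>delta\<close>, a basis witnessing the
  principal angles leads to the sines.\<close>

lemma half_frob_norm_diff_Q_kernel:
  assumes "prob_weights \<pi>" and "partition_on UNIV \<O>" and "card \<O> = Suc d" and "onb \<pi> d U u"
  shows "1 / 2 * (frob_norm \<pi> (orth_proj \<pi> U - Q_kernel \<pi> \<O>))\<^sup>2
       = d - (\<Sum>j=1..d. ip \<pi> (u j) (Q_kernel \<pi> \<O> *v u j))"
  using frob_norm_diff_projectors[OF assms(1) projector_orth_proj[OF assms(1,4)]
      projector_Q_kernel[OF assms(1,2)]]
  by (simp add: trace_orth_proj[OF assms(1,4)] trace_Q_kernel[OF assms(1,2)] assms(3)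
      trace_orth_proj_mult[OF assms(1,4)])

lemma half_frob_norm_eq_sum_sin_squares:
  assumes "prob_weights \<pi>" and "partition_on UNIV \<O>" and "card \<O> = Suc d"
    and "principal_angles \<pi> d U (V_space \<pi> \<O>) \<theta>"
  shows "1 / 2 * (frob_norm \<pi> (orth_proj \<pi> U - Q_kernel \<pi> \<O>))\<^sup>2 = (\<Sum>j=1..d. (sin (\<theta> j))\<^sup>2)"
proof -
  obtain u v where u: "onb \<pi> d U u" and v: "onb \<pi> d (V_space \<pi> \<O>) v"
    and sv: "singular_values d (cross_gram \<pi> d u v) (\<lambda>j. cos (\<theta> j))"
    using assms(4) by (auto simp: principal_angles_def)
  \<comment> \<open>As the projection onto \<open>V_space\<close>, \<open>Q_kernel\<close> can be
    expanded in the basis \<open>v\<close>.\<close>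
  have Q: "Q_kernel \<pi> \<O> = orth_proj \<pi> (V_space \<pi> \<O>)"
    unfolding V_space_def
    by (rule orth_proj_range_projector[OF assms(1) projector_Q_kernel[OF assms(1,2)], symmetric])
  have "(\<Sum>j=1..d. ip \<pi> (u j) (Q_kernel \<pi> \<O> *v u j))
      = (\<Sum>i=1..d. \<Sum>j=1..d. (ip \<pi> (u i) (v j))\<^sup>2)"
    unfolding Q by (simp add: ip_orth_proj_self[OF assms(1) v])
  \<comment> \<open>Matrix indices start at 0 and basis indices at 1; the \<open>Suc\<close> in
    \<open>cross_gram\<close> absorbs the shift.\<close>
  also have "\<dots> = (\<Sum>i<d. \<Sum>j<d. (cross_gram \<pi> d u v $$ (i, j))\<^sup>2)"
    by (simp add: cross_gram_def sum.atLeast1_atMost_eq)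
  also have "\<dots> = (\<Sum>j=1..d. (cos (\<theta> j))\<^sup>2)"
    by (rule singular_values_sum_squares[OF sv, symmetric])
  finally show ?thesis
    unfolding half_frob_norm_diff_Q_kernel[OF assms(1-3) u]
    by (simp add: sin_squared_eq sum_subtractf)
qed

theorem proposition4p1:
  fixes P :: "real ^ 'a ^ 'a::finite" and \<pi> :: "'a \<Rightarrow> real"
    and \<eta> :: "nat \<Rightarrow> real" and \<phi> :: "nat \<Rightarrow> real ^ 'a"
    and k :: nat and \<O> :: "'a set set"
  assumes "CARD('a) \<ge> 3"
    and "prob_weights \<pi>"
    and "markov_kernel P" and "ergodic_kernel P" and "reversible_kernel \<pi> P"
    and "k \<in> {2..CARD('a) - 1}"
    and "sq_eigenbasis \<pi> P \<eta> \<phi>"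
    and "partition_on UNIV \<O>" and "card \<O> = k"
  shows "delta \<pi> \<phi> (k - 1) \<O> =
           (\<Sum>B\<in>\<O>. \<Sum>x\<in>B. \<pi> x *
             (L2_set (\<lambda>j. spectral_embedding \<phi> x j - centroid \<pi> (spectral_embedding \<phi>) B j) {1..k - 1})\<^sup>2)
       \<and> (\<Sum>B\<in>\<O>. \<Sum>x\<in>B. \<pi> x *
             (L2_set (\<lambda>j. spectral_embedding \<phi> x j - centroid \<pi> (spectral_embedding \<phi>) B j) {1..k - 1})\<^sup>2) =
           1 / 2 * (frob_norm \<pi> (orth_proj \<pi> (span (\<phi> ` {1..k - 1})) - Q_kernel \<pi> \<O>))\<^sup>2
       \<and> (\<forall>\<theta>. principal_angles \<pi> (k - 1) (span (\<phi> ` {1..k - 1})) (V_space \<pi> \<O>) \<theta> \<longrightarrow>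
           1 / 2 * (frob_norm \<pi> (orth_proj \<pi> (span (\<phi> ` {1..k - 1})) - Q_kernel \<pi> \<O>))\<^sup>2 =
             (\<Sum>j=1..k - 1. (sin (\<theta> j))\<^sup>2))"
proof -
  \<comment> \<open>The subtraction is truncated; the lower bound on \<open>k\<close> makes it
    exact.\<close>
  have d: "card \<O> = Suc (k - 1)" using assms(6,9) by auto
  have onb: "onb \<pi> (CARD('a) - 1) (mean_zero \<pi>) \<phi>"
    using assms(7) by (simp add: sq_eigenbasis_def)
  have u: "onb \<pi> (k - 1) (span (\<phi> ` {1..k - 1})) \<phi>"
    by (rule onb_span_initial[OF onb]) (use assms(6) in auto)
  \<comment> \<open>Each phi_j is a unit vector of mean zero, so \<open>wnorm_compl_gibbs\<close>
    applies with leading term 1, and these terms sum to the \<open>d\<close> of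
    \<open>half_frob_norm_diff_Q_kernel\<close>.\<close>
  have "(wnorm \<pi> ((Finite_Cartesian_Product.mat 1 - gibbs_kernel \<pi> \<O>) *v \<phi> j))\<^sup>2
      = 1 - ip \<pi> (\<phi> j) (Q_kernel \<pi> \<O> *v \<phi> j)" if j: "j \<in> {1..k - 1}" for j
  proof -
    have j': "j \<in> {1..CARD('a) - 1}" using j assms(6) by auto
    then have "\<phi> j \<in> mean_zero \<pi>" using onb unfolding onb_def by (metis imageI span_base)
    moreover have "ip \<pi> (\<phi> j) (\<phi> j) = 1" using onb j' by (simp add: onb_def)
    ultimately show ?thesis by (simp add: wnorm_compl_gibbs[OF assms(2,8)])
  qed
  then have "delta \<pi> \<phi> (k - 1) \<O>
      = 1 / 2 * (frob_norm \<pi> (orth_proj \<pi> (span (\<phi> ` {1..k - 1})) - Q_kernel \<pi> \<O>))\<^sup>2"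
    unfolding half_frob_norm_diff_Q_kernel[OF assms(2,8) d u]
    by (simp add: delta_def sum_subtractf)
  then show ?thesis
    using delta_eq_kmeans_cost[OF assms(2,8), of \<phi> "k - 1"]
      half_frob_norm_eq_sum_sin_squares[OF assms(2,8) d]
    by simp
qed

end
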